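(* Let $1\le k<N$ be integers, let $R>0$ and let $b\ge0$ be a constant. Consider the problem $$\mathcal P_k^+(D^2u)+b|Du|=-1\ \text{ in }B_R,\qquad u=0\ \text{ on }\partial B_R.$$ If $0\le bR<k$, then the problem has a unique solution, which is radial, while if $bR\ge k$ there are no supersolutions of the problem.
   Context: $B_R\subset\mathbb R^N$ is the open ball of radius $R$ centered at the origin. For a symmetric $N\times N$ matrix $X$ with ordered eigenvalues $\lambda_1(X)\le\dots\le\lambda_N(X)$, $\mathcal P_k^+(X)=\sum_{i=1}^k\lambda_{N+1-i}(X)$. Equations are in the viscosity sense: an upper (resp. lower) semicontinuous real-valued $u$ is a sub- (resp. super-)solution of the equation if whenever $\varphi$ is $C^2$ near $x_0\in B_R$ and $u-\varphi$ has a local maximum (resp. minimum) at $x_0$, then $\mathcal P_k^+(D^2\varphi(x_0))+b|D\varphi(x_0)|\ge-1$ (resp. $\le-1$). A solution of the problem is $u\in C(\overline{B_R})$ that is both a sub- and supersolution in $B_R$ with $u=0$ on $\partial B_R$. A supersolution of the problem is a real-valued lower semicontinuous function on $\overline{B_R}$ that is a supersolution of the equation in $B_R$ and satisfies $u\ge0$ on $\partial B_R$. *)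

theory Defs
  imports "HOL-Analysis.Analysis" "HOL-Library.Multiset"
begin

text \<open>
  For a symmetric matrix the geometric multiplicity of an eigenvalue (the dimension of its
  eigenspace) equals its algebraic one, so the list below has length \<open>CARD('n)\<close>.
  Nothing is claimed for matrices that are not symmetric.
\<close>

definition eigenvalues :: "real^'n^'n \<Rightarrow> real set" where
  "eigenvalues X = {l. \<exists>v. v \<noteq> 0 \<and> X *v v = l *\<^sub>R v}"

definition ordered_eigenvalues :: "real^'n^'n \<Rightarrow> real list" where
  "ordered_eigenvalues X =
     sorted_list_of_multiset
       (\<Sum>l\<in>eigenvalues X. replicate_mset (dim {v. X *v v = l *\<^sub>R v}) l)"

text \<open>
  \<open>lambda_eig X i\<close> is $\lambda_i(X)$ with indices $1 \le i \le N$; lists are indexed from 0.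
\<close>

definition lambda_eig :: "real^'n^'n \<Rightarrow> nat \<Rightarrow> real" where
  "lambda_eig X i = ordered_eigenvalues X ! (i - 1)"

definition Pk_plus :: "nat \<Rightarrow> real^'n^'n \<Rightarrow> real" where
  "Pk_plus k X = (\<Sum>i=1..k. lambda_eig X (CARD('n) + 1 - i))"

text \<open>
  \<open>\<phi>\<close> is $C^2$ on the open set \<open>U\<close>, with gradient \<open>D\<phi>\<close> and Hessian \<open>D2\<phi>\<close>.
\<close>

definition C2_on :: "(real^'n) set \<Rightarrow> (real^'n \<Rightarrow> real) \<Rightarrow> (real^'n \<Rightarrow> real^'n)
    \<Rightarrow> (real^'n \<Rightarrow> real^'n^'n) \<Rightarrow> bool" where
  "C2_on U \<phi> D\<phi> D2\<phi> \<longleftrightarrow>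
     open U \<and> (\<forall>x\<in>U. GDERIV \<phi> x :> D\<phi> x) \<and>
     (\<forall>x\<in>U. (D\<phi> has_derivative (\<lambda>h. D2\<phi> x *v h)) (at x)) \<and>
     continuous_on U D2\<phi>"

definition usc_on :: "'a::topological_space set \<Rightarrow> ('a \<Rightarrow> real) \<Rightarrow> bool" where
  "usc_on S u \<longleftrightarrow> (\<forall>x\<in>S. \<forall>c>u x. \<forall>\<^sub>F y in at x within S. u y < c)"

definition lsc_on :: "'a::topological_space set \<Rightarrow> ('a \<Rightarrow> real) \<Rightarrow> bool" where
  "lsc_on S u \<longleftrightarrow> (\<forall>x\<in>S. \<forall>c<u x. \<forall>\<^sub>F y in at x within S. c < u y)"

text \<open>
  Viscosity sub- and supersolutions of $\mathcal P_k^+(D^2u) + b|Du| = -1$ in the open ball of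
  radius \<open>R\<close> about the origin. As the ball is open, the filter \<open>nhds x0\<close> only sees values
  of \<open>u\<close> in the ball.
\<close>

definition visc_subsolution :: "nat \<Rightarrow> real \<Rightarrow> real \<Rightarrow> (real^'n \<Rightarrow> real) \<Rightarrow> bool" where
  "visc_subsolution k b R u \<longleftrightarrow>
     usc_on (ball 0 R) u \<and>
     (\<forall>x0\<in>ball 0 R. \<forall>U \<phi> D\<phi> D2\<phi>.
        x0 \<in> U \<longrightarrow> C2_on U \<phi> D\<phi> D2\<phi> \<longrightarrow>
        (\<forall>\<^sub>F x in nhds x0. u x - \<phi> x \<le> u x0 - \<phi> x0) \<longrightarrow>
        Pk_plus k (D2\<phi> x0) + b * norm (D\<phi> x0) \<ge> -1)"

definition visc_supersolution :: "nat \<Rightarrow> real \<Rightarrow> real \<Rightarrow> (real^'n \<Rightarrow> real) \<Rightarrow> bool" where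
  "visc_supersolution k b R u \<longleftrightarrow>
     lsc_on (ball 0 R) u \<and>
     (\<forall>x0\<in>ball 0 R. \<forall>U \<phi> D\<phi> D2\<phi>.
        x0 \<in> U \<longrightarrow> C2_on U \<phi> D\<phi> D2\<phi> \<longrightarrow>
        (\<forall>\<^sub>F x in nhds x0. u x - \<phi> x \<ge> u x0 - \<phi> x0) \<longrightarrow>
        Pk_plus k (D2\<phi> x0) + b * norm (D\<phi> x0) \<le> -1)"

text \<open>
  Functions are total in HOL; only the values on \<open>cball 0 R\<close> matter below.
\<close>

definition dirichlet_solution :: "nat \<Rightarrow> real \<Rightarrow> real \<Rightarrow> (real^'n \<Rightarrow> real) \<Rightarrow> bool" where
  "dirichlet_solution k b R u \<longleftrightarrow>
     continuous_on (cball 0 R) u \<and> visc_subsolution k b R u \<and> visc_supersolution k b R u \<and>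
     (\<forall>x\<in>sphere 0 R. u x = 0)"

definition dirichlet_supersolution :: "nat \<Rightarrow> real \<Rightarrow> real \<Rightarrow> (real^'n \<Rightarrow> real) \<Rightarrow> bool" where
  "dirichlet_supersolution k b R u \<longleftrightarrow>
     lsc_on (cball 0 R) u \<and> visc_supersolution k b R u \<and> (\<forall>x\<in>sphere 0 R. u x \<ge> 0)"

definition radial_on :: "(real^'n) set \<Rightarrow> (real^'n \<Rightarrow> real) \<Rightarrow> bool" where
  "radial_on S u \<longleftrightarrow> (\<exists>g. \<forall>x\<in>S. u x = g (norm x))"

end

theory Submission
  imports Defs
begin

text \<open>
  For a radial function $g(|x|)$ with $g'' \le g'/r \le 0$ the $k < N$ largest eigenvalues of the
  Hessian all equal $g'/r$, so the equation becomes $k g'/r - b g' = -1$, that is $g' = -r/(k - br)$.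
  For $bR < k$ this gives an explicit $C^2$ solution. Because it is $C^2$, it can be used itself
  (after multiplication by a factor close to $1$, which makes it strict) as a test function, and
  uniqueness needs no doubling of variables. For $bR \ge k$, a supersolution is nonnegative and
  hence lies above the explicit solution in every ball $B_\rho$ with $b\rho < k$; the value of the
  latter at the origin tends to infinity as $\rho \to k/b$.
\<close>

section \<open>Extremal eigenvalue sums of symmetric matrices\<close>

text \<open>\<open>Pk_plus\<close> is defined through a sorted list of eigenvalues, so neither its
  monotonicity nor a min-max formula is immediate. The spectral theorem serves to read this list off
  an orthonormal eigenbasis; after that two bounds suffice. A quadratic form at most a|y|^2
  everywhere gives P_k^+ <= ka, and one at least a|y|^2 on a single hyperplane gives P_k^+ >= ka.
  The second bound is where k < N enters: a hyperplane bound leaves at most one eigenvalue below a,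
  and the k largest omit at least the smallest. For the radial solution the hyperplane is the
  tangential one and the exceptional direction is the radial one. The test functions are arbitrary,
  and \<open>C2_on\<close> gives their Hessians only as derivatives of gradients, so symmetry has to
  be proved before either bound applies. The norm is not differentiable at the origin. Writing the
  gradient of g(|x|) as h(|x|) x with h = g'/r = -1/(k - br), which is smooth up to r = 0, yields
  one Hessian formula h I + (h'/|x|) x x^T for all points of the ball.\<close>

lemma selfadjoint_eigenvector_exists:
  fixes f :: "'a::euclidean_space \<Rightarrow> 'a"
  assumes lin: "linear f" and sym: "\<And>x y. f x \<bullet> y = x \<bullet> f y"
    and S: "subspace S" and inv: "\<And>x. x \<in> S \<Longrightarrow> f x \<in> S" and ne: "\<exists>x\<in>S. x \<noteq> 0"
  shows "\<exists>v\<in>S. \<exists>l. norm v = 1 \<and> f v = l *\<^sub>R v"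
proof -
  interpret linear f by (rule lin)
  \<comment> \<open>The eigenvector is a maximiser of the Rayleigh quotient on the unit sphere of
    \<open>S\<close>.\<close>
  let ?K = "S \<inter> sphere 0 1"
  have "compact ?K"
    by (intro closed_Int_compact closed_subspace S) simp
  moreover have "?K \<noteq> {}"
  proof -
    obtain x where "x \<in> S" "x \<noteq> 0" using ne by auto
    then have "x /\<^sub>R norm x \<in> ?K" using S by (simp add: subspace_scale)
    then show ?thesis by blast
  qed
  moreover have "continuous_on ?K (\<lambda>x. f x \<bullet> x)"
    using lin by (intro continuous_intros) (simp add: linear_continuous_on linear_conv_bounded_linear)
  ultimately obtain v where v: "v \<in> ?K" and max: "\<And>y. y \<in> ?K \<Longrightarrow> f y \<bullet> y \<le> f v \<bullet> v"
    using continuous_attains_sup[of ?K "\<lambda>x. f x \<bullet> x"] by blast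
  define l where "l = f v \<bullet> v"
  \<comment> \<open>\<open>q\<close> is nonnegative on \<open>S\<close> and vanishes at
    \<open>v\<close>. The vector \<open>w\<close> below is half its gradient at \<open>v\<close>, so
    a small step along -w would make \<open>q\<close> negative unless w = 0.\<close>
  define q where "q y = l * (y \<bullet> y) - f y \<bullet> y" for y
  have q_nonneg: "q y \<ge> 0" if "y \<in> S" for y
  proof (cases "y = 0")
    case True then show ?thesis by (simp add: q_def)
  next
    case False
    then have "y /\<^sub>R norm y \<in> ?K" using S that by (simp add: subspace_scale)
    from max[OF this] have "(f y \<bullet> y) / (norm y)\<^sup>2 \<le> l"
      by (simp add: scale l_def power2_eq_square divide_inverse mult_ac)
    then show ?thesis using False
      by (simp add: q_def divide_le_eq power2_norm_eq_inner)
  qed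
  define w where "w = l *\<^sub>R v - f v"
  have "v \<in> S" "norm v = 1" using v by auto
  then have vv: "v \<bullet> v = 1" by (simp add: norm_eq_1)
  have wS: "w \<in> S"
    unfolding w_def using \<open>v \<in> S\<close> S inv by (simp add: subspace_diff subspace_scale)
  have expand: "q (v - s *\<^sub>R w) = s\<^sup>2 * q w - 2 * s * (w \<bullet> w)" for s
  proof -
    have "f w \<bullet> v = f v \<bullet> w" using sym by (metis inner_commute)
    then have "q (v - s *\<^sub>R w) = s\<^sup>2 * q w - 2 * s * (l * (v \<bullet> w) - f v \<bullet> w)"
      using vv unfolding q_def
      by (simp add: diff scale inner_diff_left inner_diff_right l_def[symmetric]
          inner_commute[of w v] power2_eq_square algebra_simps)
    moreover have "w \<bullet> w = l * (v \<bullet> w) - f v \<bullet> w"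
      by (subst (1) w_def) (simp add: inner_diff_left)
    ultimately show ?thesis by simp
  qed
  have "w \<bullet> w = 0"
  proof (rule ccontr)
    assume "w \<bullet> w \<noteq> 0"
    then have pos: "w \<bullet> w > 0" by simp
    have qw: "q w \<ge> 0" using q_nonneg wS by auto
    \<comment> \<open>This step is short enough for the linear term of \<open>expand\<close> to beat
      the quadratic one; the added 1 covers the case q w = 0.\<close>
    define s where "s = (w \<bullet> w) / (q w + 1)"
    have s: "s > 0" using pos qw by (simp add: s_def)
    have "v - s *\<^sub>R w \<in> S" using \<open>v \<in> S\<close> wS S by (simp add: subspace_diff subspace_scale)
    from q_nonneg[OF this] have "0 \<le> s * (s * q w - 2 * (w \<bullet> w))"
      unfolding expand by (simp add: algebra_simps power2_eq_square)
    then have "2 * (w \<bullet> w) \<le> s * q w" using s by (simp add: zero_le_mult_iff)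
    also have "\<dots> \<le> s * (q w + 1)" using s by simp
    also have "\<dots> = w \<bullet> w" using qw by (simp add: s_def)
    finally show False using pos by simp
  qed
  then have "f v = l *\<^sub>R v" by (simp add: w_def)
  then show ?thesis using \<open>v \<in> S\<close> \<open>norm v = 1\<close> by auto
qed

text \<open>Take an orthonormal set of eigenvectors of greatest cardinality. If it did not span, its
  orthogonal complement, which is invariant by self-adjointness, would contain one more
  eigenvector.\<close>

lemma selfadjoint_orthonormal_eigenbasis:
  fixes f :: "'a::euclidean_space \<Rightarrow> 'a"
  assumes lin: "linear f" and sym: "\<And>x y. f x \<bullet> y = x \<bullet> f y"
  obtains B where "pairwise orthogonal B" "\<And>b. b \<in> B \<Longrightarrow> norm b = 1"
    "\<And>b. b \<in> B \<Longrightarrow> f b = (f b \<bullet> b) *\<^sub>R b" "span B = UNIV" "independent B"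
proof -
  let ?P = "\<lambda>B. pairwise orthogonal B \<and> (\<forall>b\<in>B. norm b = 1 \<and> f b = (f b \<bullet> b) *\<^sub>R b)"
  have ind: "independent B" if "?P B" for B
    using that by (intro pairwise_orthogonal_independent) auto
  have bound: "card B < Suc DIM('a)" if "?P B" for B
    using ind[OF that] independent_bound[of B] by simp
  have "?P {}" by simp
  from ex_has_greatest_nat[of ?P "{}" card "Suc DIM('a)", OF this]
  have "\<exists>B. ?P B \<and> (\<forall>C. ?P C \<longrightarrow> card C \<le> card B)"
    using bound less_imp_le by blast
  then obtain B where B: "?P B" and mx: "\<And>C. ?P C \<Longrightarrow> card C \<le> card B"
    by blast
  have fin: "finite B" using ind[OF B] independent_bound by blast
  have "span B = UNIV"
  proof (rule ccontr)
    assume "span B \<noteq> UNIV"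
    then have "dim B < DIM('a)" by (metis dim_eq_full dim_subset_UNIV le_neq_implies_less)
    then obtain x where x: "x \<noteq> 0" "\<And>y. y \<in> span B \<Longrightarrow> orthogonal x y"
      using orthogonal_to_subspace_exists by blast
    define S where "S = {x. \<forall>b\<in>B. x \<bullet> b = 0}"
    have "subspace S" by (simp add: S_def subspace_def inner_add_left)
    moreover have "f y \<in> S" if "y \<in> S" for y
    proof -
      have "f y \<bullet> b = 0" if "b \<in> B" for b
      proof -
        have "f y \<bullet> b = y \<bullet> ((f b \<bullet> b) *\<^sub>R b)" using sym B that by metis
        then show ?thesis using \<open>y \<in> S\<close> that by (simp add: S_def)
      qed
      then show ?thesis by (simp add: S_def)
    qed
    moreover have "x \<in> S" using x by (auto simp: S_def orthogonal_def span_base)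
    ultimately obtain v l where v: "v \<in> S" "norm v = 1" "f v = l *\<^sub>R v"
      using selfadjoint_eigenvector_exists[OF lin sym] x(1) by metis
    have "v \<notin> B" using v by (auto simp: S_def)
    moreover have "?P (insert v B)"
      using v B by (auto simp: S_def pairwise_insert orthogonal_def inner_commute norm_eq_1)
    ultimately show False using mx[of "insert v B"] fin by simp
  qed
  then show ?thesis using that B ind[OF B] by blast
qed

text \<open>By symmetry (l b - t)(v . b) = 0 for every eigenvector v with eigenvalue t, so v
  involves only basis vectors with l b = t. Each eigenspace is therefore spanned by the basis
  vectors it contains, and its dimension counts them.\<close>

lemma ordered_eigenvalues_eigenbasis:
  fixes X :: "real^'n^'n"
  assumes sym: "\<And>x y. (X *v x) \<bullet> y = x \<bullet> (X *v y)"
    and orth: "pairwise orthogonal B" and norm1: "\<And>b. b \<in> B \<Longrightarrow> norm b = 1"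
    and eig: "\<And>b. b \<in> B \<Longrightarrow> X *v b = l b *\<^sub>R b"
    and span: "span B = UNIV" and ind: "independent B"
  shows "mset (ordered_eigenvalues X) = image_mset l (mset_set B)"
proof -
  have fin: "finite B" using ind independent_bound by blast
  have coeff: "X *v v = t *\<^sub>R v \<Longrightarrow> b \<in> B \<Longrightarrow> v \<bullet> b \<noteq> 0 \<Longrightarrow> l b = t" for v t b
    using sym[of v b] eig[of b] by simp
  have expand: "v = (\<Sum>b\<in>B. (v \<bullet> b) *\<^sub>R b)" for v
    using orthonormal_basis_expand[OF orth norm1, of v] span fin by simp
  have eigs: "eigenvalues X = l ` B"
  proof
    show "eigenvalues X \<subseteq> l ` B"
    proof
      fix t assume "t \<in> eigenvalues X"
      then obtain v where v: "v \<noteq> 0" "X *v v = t *\<^sub>R v" by (auto simp: eigenvalues_def)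
      then obtain b where "b \<in> B" "v \<bullet> b \<noteq> 0"
        using expand[of v] by (metis (no_types, lifting) scale_eq_0_iff sum.neutral)
      then show "t \<in> l ` B" using coeff v by blast
    qed
    show "l ` B \<subseteq> eigenvalues X"
    proof
      fix t assume "t \<in> l ` B"
      then obtain b where "b \<in> B" "t = l b" by blast
      moreover have "b \<noteq> 0" using norm1[OF \<open>b \<in> B\<close>] by auto
      ultimately show "t \<in> eigenvalues X" using eig by (auto simp: eigenvalues_def)
    qed
  qed
  have dim: "dim {v. X *v v = t *\<^sub>R v} = card {b\<in>B. l b = t}" for t
  proof -
    have "{v. X *v v = t *\<^sub>R v} = span {b\<in>B. l b = t}"
    proof
      show "{v. X *v v = t *\<^sub>R v} \<subseteq> span {b\<in>B. l b = t}"
      proof clarify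
        fix v assume v: "X *v v = t *\<^sub>R v"
        have "(v \<bullet> b) *\<^sub>R b \<in> span {b\<in>B. l b = t}" if "b \<in> B" for b
          using coeff[OF v that] that by (cases "v \<bullet> b = 0") (auto simp: span_base span_scale span_zero)
        then show "v \<in> span {b\<in>B. l b = t}"
          by (subst expand) (rule span_sum)
      qed
      show "span {b\<in>B. l b = t} \<subseteq> {v. X *v v = t *\<^sub>R v}"
        by (rule span_minimal)
          (auto simp: eig subspace_def matrix_vector_right_distrib scaleR_add_right matrix_vector_mult_scaleR)
    qed
    moreover have "independent {b\<in>B. l b = t}"
      using ind by (rule independent_mono) auto
    ultimately show ?thesis using dim_span_eq_card_independent by metis
  qed
  have "mset (ordered_eigenvalues X) = (\<Sum>t\<in>l ` B. replicate_mset (card {b\<in>B. l b = t}) t)"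
    by (simp add: ordered_eigenvalues_def eigs dim)
  also have "\<dots> = image_mset l (mset_set B)"
  proof (rule multiset_eqI)
    fix t
    have "count (\<Sum>s\<in>l ` B. replicate_mset (card {b\<in>B. l b = s}) s) t =
      (\<Sum>s\<in>l ` B. if t = s then card {b\<in>B. l b = s} else 0)"
      by (simp add: count_sum)
    also have "\<dots> = card {b\<in>B. l b = t}"
      using fin by (auto simp: sum.delta card_eq_0_iff)
    also have "\<dots> = count (image_mset l (mset_set B)) t"
      using fin by (auto simp: count_image_mset vimage_def Int_def conj_commute intro!: arg_cong[where f=card])
    finally show "count (\<Sum>s\<in>l ` B. replicate_mset (card {b\<in>B. l b = s}) s) t =
      count (image_mset l (mset_set B)) t" .
  qed
  finally show ?thesis .
qed

lemma selfadjoint_matrix_eigenbasis: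
  fixes X :: "real^'n^'n"
  assumes "\<And>x y. (X *v x) \<bullet> y = x \<bullet> (X *v y)"
  obtains B where "finite B" "card B = CARD('n)" "pairwise orthogonal B"
    "\<And>b. b \<in> B \<Longrightarrow> norm b = 1" "\<And>b. b \<in> B \<Longrightarrow> X *v b = ((X *v b) \<bullet> b) *\<^sub>R b"
    "mset (ordered_eigenvalues X) = image_mset (\<lambda>b. (X *v b) \<bullet> b) (mset_set B)"
proof -
  obtain B where B: "pairwise orthogonal B" "\<And>b. b \<in> B \<Longrightarrow> norm b = 1"
    "\<And>b. b \<in> B \<Longrightarrow> X *v b = ((X *v b) \<bullet> b) *\<^sub>R b" "span B = UNIV" "independent B"
    using selfadjoint_orthonormal_eigenbasis[of "(*v) X"] assms by (metis matrix_vector_mul_linear)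
  have "card B = CARD('n)"
    using B(4,5) dim_span_eq_card_independent[of B] by simp
  moreover have "finite B" using B(5) independent_bound by blast
  ultimately show ?thesis
    using that B ordered_eigenvalues_eigenbasis[OF assms B(1,2,3,4,5)] by blast
qed

lemma Pk_plus_le:
  fixes X :: "real^'n^'n"
  assumes sym: "\<And>x y. (X *v x) \<bullet> y = x \<bullet> (X *v y)" and k: "k \<le> CARD('n)"
    and le: "\<And>y. (X *v y) \<bullet> y \<le> a * (y \<bullet> y)"
  shows "Pk_plus k X \<le> real k * a"
proof -
  obtain B where B: "finite B" "card B = CARD('n)" "\<And>b. b \<in> B \<Longrightarrow> norm b = 1"
    "mset (ordered_eigenvalues X) = image_mset (\<lambda>b. (X *v b) \<bullet> b) (mset_set B)"
    using selfadjoint_matrix_eigenbasis[OF sym] by metis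
  have len: "length (ordered_eigenvalues X) = CARD('n)"
    using arg_cong[OF B(4), of size] B(1,2) by simp
  have elem: "x \<le> a" if "x \<in> set (ordered_eigenvalues X)" for x
  proof -
    have "x \<in> (\<lambda>b. (X *v b) \<bullet> b) ` B"
      using arg_cong[OF B(4), of set_mset] B(1) that by simp
    then obtain b where "b \<in> B" "x = (X *v b) \<bullet> b" by blast
    then show ?thesis using le[of b] B(3)[of b] by (simp add: norm_eq_1)
  qed
  have "lambda_eig X (CARD('n) + 1 - i) \<le> a" if "i \<in> {1..k}" for i
    unfolding lambda_eig_def using len k that by (intro elem nth_mem) auto
  then show ?thesis
    unfolding Pk_plus_def using sum_bounded_above[of "{1..k}" _ a] by simp
qed

text \<open>
  A weak form of Courant--Fischer: two orthonormal eigenvectors with eigenvalues below \<open>a\<close>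
  would span a plane, which meets the hyperplane orthogonal to \<open>z\<close> nontrivially.
\<close>

lemma Pk_plus_ge:
  fixes X :: "real^'n^'n"
  assumes sym: "\<And>x y. (X *v x) \<bullet> y = x \<bullet> (X *v y)" and k: "k < CARD('n)"
    and ge: "\<And>y. y \<bullet> z = 0 \<Longrightarrow> (X *v y) \<bullet> y \<ge> a * (y \<bullet> y)"
  shows "Pk_plus k X \<ge> real k * a"
proof -
  obtain B where B: "finite B" "card B = CARD('n)" "pairwise orthogonal B"
    "\<And>b. b \<in> B \<Longrightarrow> norm b = 1" "\<And>b. b \<in> B \<Longrightarrow> X *v b = ((X *v b) \<bullet> b) *\<^sub>R b"
    "mset (ordered_eigenvalues X) = image_mset (\<lambda>b. (X *v b) \<bullet> b) (mset_set B)"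
    using selfadjoint_matrix_eigenbasis[OF sym] by blast
  let ?xs = "ordered_eigenvalues X"
  let ?l = "\<lambda>b. (X *v b) \<bullet> b"
  have len: "length ?xs = CARD('n)"
    using arg_cong[OF B(6), of size] B(1,2) by simp
  have srt: "sorted ?xs" by (simp add: ordered_eigenvalues_def)
  have card: "card {b\<in>B. ?l b < a} \<le> 1"
  proof (rule ccontr)
    assume "\<not> ?thesis"
    then obtain b c where bc: "b \<in> B" "c \<in> B" "b \<noteq> c" and lt: "?l b < a" "?l c < a"
      by (auto simp: not_le One_nat_def card_le_Suc0_iff_eq B(1))
    have o: "b \<bullet> c = 0" "c \<bullet> b = 0" "b \<bullet> b = 1" "c \<bullet> c = 1"
      using bc B(3,4) by (auto simp: pairwise_def orthogonal_def norm_eq_1)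
    obtain p q where pq: "p * (b \<bullet> z) + q * (c \<bullet> z) = 0" "p \<noteq> 0 \<or> q \<noteq> 0"
    proof (cases "b \<bullet> z = 0")
      case True
      then show thesis using that[of 1 0] by simp
    next
      case False
      then show thesis using that[of "c \<bullet> z" "- (b \<bullet> z)"] by simp
    qed
    define y where "y = p *\<^sub>R b + q *\<^sub>R c"
    have "y \<bullet> z = 0" using pq by (simp add: y_def inner_add_left)
    from ge[OF this] have "a * (y \<bullet> y) \<le> (X *v y) \<bullet> y" .
    moreover have "y \<bullet> y = p\<^sup>2 + q\<^sup>2"
      by (simp add: y_def inner_add_left inner_add_right o power2_eq_square)
    moreover have "(X *v y) \<bullet> y = p\<^sup>2 * ?l b + q\<^sup>2 * ?l c"
    proof -
      define s t where "s = ?l b" and "t = ?l c"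
      have "X *v y = (p * s) *\<^sub>R b + (q * t) *\<^sub>R c"
        unfolding y_def matrix_vector_right_distrib matrix_vector_mult_scaleR
        using B(5)[OF bc(1), folded s_def] B(5)[OF bc(2), folded t_def]
        by (metis scaleR_scaleR)
      then show ?thesis
        unfolding s_def[symmetric] t_def[symmetric]
        by (simp add: y_def inner_add_left inner_add_right o power2_eq_square)
    qed
    ultimately have "p\<^sup>2 * (a - ?l b) + q\<^sup>2 * (a - ?l c) \<le> 0" by (simp add: algebra_simps)
    moreover have "p\<^sup>2 * (a - ?l b) \<ge> 0" "q\<^sup>2 * (a - ?l c) \<ge> 0" using lt by auto
    ultimately have "p\<^sup>2 * (a - ?l b) = 0" "q\<^sup>2 * (a - ?l c) = 0" by linarith+
    then show False using lt pq(2) by auto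
  qed
  \<comment> \<open>The list is sorted, so an entry below \<open>a\<close> at a position i >= 1
    forces the entry at position 0 below \<open>a\<close> too. That makes two basis vectors with
    eigenvalue below \<open>a\<close>, against \<open>card\<close>.\<close>
  have nth: "?xs ! i \<ge> a" if "1 \<le> i" "i < CARD('n)" for i
  proof (rule ccontr)
    assume "\<not> ?thesis"
    then have i: "?xs ! i < a" by simp
    have "?xs ! 0 \<le> ?xs ! i" using srt that len by (simp add: sorted_nth_mono)
    then have "{0, i} \<subseteq> {j. j < length ?xs \<and> ?xs ! j < a}" using i that len by auto
    then have "card {0, i} \<le> card {j. j < length ?xs \<and> ?xs ! j < a}"
      by (intro card_mono) auto
    then have "2 \<le> length (filter (\<lambda>x. x < a) ?xs)"
      using that by (simp add: length_filter_conv_card)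
    also have "\<dots> = size (filter_mset (\<lambda>x. x < a) (mset ?xs))"
      by (metis mset_filter size_mset)
    also have "\<dots> = card {b\<in>B. ?l b < a}"
      unfolding B(6) using B(1) by (simp add: filter_mset_image_mset)
    finally show False using card by simp
  qed
  \<comment> \<open>The list position is N - i, and i <= k < N keeps it at least 1: the possibly
    small entry at position 0 is never summed.\<close>
  have "lambda_eig X (CARD('n) + 1 - i) \<ge> a" if "i \<in> {1..k}" for i
    unfolding lambda_eig_def using k that by (intro nth) auto
  then show ?thesis
    unfolding Pk_plus_def using sum_bounded_below[of "{1..k}" a] by simp
qed

section \<open>Second-order conditions at a touching point\<close>

text \<open>The mean value theorem in direction \<open>u\<close>, applied to the difference of
  \<phi> along two parallel lines shifted by t v, turns the second difference into t times a
  difference of gradients, which differentiability of \<open>D\<close> at \<open>x\<close>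
  evaluates. The quotient is symmetric in \<open>u\<close> and \<open>v\<close>, hence so is the
  limit; this is the source of the symmetry of Hessians.\<close>

lemma second_difference_tendsto:
  fixes \<phi> :: "'a::real_inner \<Rightarrow> real"
  assumes U: "open U" "x \<in> U" and grad: "\<And>y. y \<in> U \<Longrightarrow> GDERIV \<phi> y :> D y"
    and D: "(D has_derivative D') (at x)"
  shows "((\<lambda>t. (\<phi> (x + t *\<^sub>R u + t *\<^sub>R v) - \<phi> (x + t *\<^sub>R u) - \<phi> (x + t *\<^sub>R v) + \<phi> x) / t\<^sup>2)
    \<longlongrightarrow> D' v \<bullet> u) (at_right 0)"
proof (rule tendstoI)
  fix e :: real assume e: "e > 0"
  \<comment> \<open>\<open>M\<close> dominates (2|u| + |v|)|u|, the factor multiplying the two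
    linearisation errors, and the added ones keep it positive. The choice of \<open>e'\<close> then
    makes the total error at most e t / 2.\<close>
  define M where "M = (2 * norm u + norm v + 1) * (norm u + 1)"
  have M: "M > 0" unfolding M_def by (intro mult_pos_pos add_nonneg_pos) auto
  define e' where "e' = e / (2 * M)"
  have e': "e' > 0" using e M by (simp add: e'_def)
  interpret D': bounded_linear D' using D by (rule has_derivative_bounded_linear)
  obtain d1 where d1: "d1 > 0" and lin: "\<And>y. norm (y - x) < d1 \<Longrightarrow>
      norm (D y - D x - D' (y - x)) \<le> e' * norm (y - x)"
    using D e' unfolding has_derivative_at_alt by blast
  obtain d2 where d2: "d2 > 0" "ball x d2 \<subseteq> U" using U open_contains_ball by blast
  have in_U: "x + h \<in> U" if "norm h < d2" for h
    using that by (intro subsetD[OF d2(2)]) (simp add: dist_norm)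
  \<comment> \<open>For t < d the whole parallelogram with sides t u and t v at \<open>x\<close>
    lies in \<open>U\<close> and in the range where \<open>D\<close> is linearised up to
    \<open>e'\<close>.\<close>
  define d where "d = min d1 d2 / (norm u + norm v + 1)"
  have d: "d > 0" using d1 d2 unfolding d_def by (intro divide_pos_pos add_nonneg_pos) auto
  have small: "norm (s *\<^sub>R u + r *\<^sub>R v) < min d1 d2"
    if "0 \<le> s" "s \<le> t" "0 \<le> r" "r \<le> t" "0 < t" "t < d" for s r t
  proof -
    have "norm (s *\<^sub>R u + r *\<^sub>R v) \<le> s * norm u + r * norm v"
      using that norm_triangle_ineq[of "s *\<^sub>R u" "r *\<^sub>R v"] by simp
    also have "\<dots> \<le> t * norm u + t * norm v"
      using that by (intro add_mono mult_right_mono) auto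
    also have "\<dots> < t * (norm u + norm v + 1)" using that by (simp add: algebra_simps)
    also have "\<dots> \<le> d * (norm u + norm v + 1)" using that by (intro mult_right_mono) auto
    also have "\<dots> = min d1 d2"
      unfolding d_def by (subst nonzero_eq_divide_eq[symmetric]) (auto simp: add_nonneg_eq_0_iff)
    finally show ?thesis .
  qed
  show "\<forall>\<^sub>F t in at_right 0. dist ((\<phi> (x + t *\<^sub>R u + t *\<^sub>R v) - \<phi> (x + t *\<^sub>R u)
      - \<phi> (x + t *\<^sub>R v) + \<phi> x) / t\<^sup>2) (D' v \<bullet> u) < e"
    unfolding eventually_at_right_field
  proof (intro exI[of _ d] conjI d allI impI)
    fix t :: real assume t: "0 < t" "t < d"
    let ?f = "\<lambda>s. \<phi> (x + s *\<^sub>R u + t *\<^sub>R v) - \<phi> (x + s *\<^sub>R u)"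
    let ?f' = "\<lambda>s. D (x + s *\<^sub>R u + t *\<^sub>R v) \<bullet> u - D (x + s *\<^sub>R u) \<bullet> u"
    have "(?f has_real_derivative ?f' s) (at s)" if "0 \<le> s" "s \<le> t" for s
    proof -
      have "x + s *\<^sub>R u + t *\<^sub>R v \<in> U" "x + s *\<^sub>R u \<in> U"
        using small[of s t t] small[of s t 0] that t
        by (auto intro!: in_U simp: add.assoc)
      then have *: "(\<phi> has_derivative (\<lambda>h. h \<bullet> D (x + s *\<^sub>R u + t *\<^sub>R v))) (at (x + s *\<^sub>R u + t *\<^sub>R v))"
          "(\<phi> has_derivative (\<lambda>h. h \<bullet> D (x + s *\<^sub>R u))) (at (x + s *\<^sub>R u))"
        using grad by (auto simp: gderiv_def)
      have "(?f has_derivative (\<lambda>h. (h *\<^sub>R u) \<bullet> D (x + s *\<^sub>R u + t *\<^sub>R v) - (h *\<^sub>R u) \<bullet> D (x + s *\<^sub>R u))) (at s)"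
        by (intro has_derivative_diff
            has_derivative_compose[where f = "\<lambda>s. x + s *\<^sub>R u + t *\<^sub>R v" and g = \<phi>, OF _ *(1)]
            has_derivative_compose[where f = "\<lambda>s. x + s *\<^sub>R u" and g = \<phi>, OF _ *(2)])
          (auto intro!: derivative_eq_intros)
      then show ?thesis
        by (rule has_derivative_imp_has_field_derivative) (simp add: inner_commute algebra_simps)
    qed
    from MVT2[OF t(1) this] obtain s where s: "0 < s" "s < t" "?f t - ?f 0 = (t - 0) * ?f' s"
      by blast
    let ?y = "x + s *\<^sub>R u + t *\<^sub>R v" and ?z = "x + s *\<^sub>R u"
    have "norm (D ?y - D ?z - D' (t *\<^sub>R v)) =
        norm ((D ?y - D x - D' (?y - x)) - (D ?z - D x - D' (?z - x)))"
      by (intro arg_cong[where f = norm]) (simp add: D'.add add.assoc algebra_simps)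
    also have "\<dots> \<le> e' * norm (?y - x) + e' * norm (?z - x)"
    proof (rule order_trans[OF norm_triangle_ineq4 add_mono])
      show "norm (D ?y - D x - D' (?y - x)) \<le> e' * norm (?y - x)"
        using small[of s t t] s t by (intro lin) (simp add: add.assoc)
      show "norm (D ?z - D x - D' (?z - x)) \<le> e' * norm (?z - x)"
        using small[of s t 0] s t by (intro lin) simp
    qed
    also have "\<dots> \<le> e' * (t * norm u + t * norm v) + e' * (t * norm u)"
    proof (intro add_mono mult_left_mono)
      show "norm (?y - x) \<le> t * norm u + t * norm v"
        using s t norm_triangle_ineq[of "s *\<^sub>R u" "t *\<^sub>R v"]
          mult_right_mono[of s t "norm u"] by (simp add: add.assoc)
      show "norm (?z - x) \<le> t * norm u"
        using s mult_right_mono[of s t "norm u"] by simp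
    qed (use e' in auto)
    also have "\<dots> = e' * t * (2 * norm u + norm v)" by (simp add: algebra_simps)
    finally have n: "norm (D ?y - D ?z - D' (t *\<^sub>R v)) \<le> e' * t * (2 * norm u + norm v)" .
    have "\<bar>?f' s - t * (D' v \<bullet> u)\<bar> = \<bar>(D ?y - D ?z - D' (t *\<^sub>R v)) \<bullet> u\<bar>"
      by (simp add: inner_diff_left D'.scaleR)
    also have "\<dots> \<le> norm (D ?y - D ?z - D' (t *\<^sub>R v)) * norm u" by (rule Cauchy_Schwarz_ineq2)
    also have "\<dots> \<le> (e' * t * (2 * norm u + norm v)) * norm u"
      using n by (intro mult_right_mono) auto
    also have "\<dots> \<le> e' * t * M"
      unfolding M_def using e' t by (simp add: mult.assoc mult_left_mono mult_mono)
    also have "\<dots> < e * t"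
      using M e t by (simp add: e'_def field_simps)
    finally have fin: "\<bar>?f' s - t * (D' v \<bullet> u)\<bar> < e * t" .
    have "(\<phi> (x + t *\<^sub>R u + t *\<^sub>R v) - \<phi> (x + t *\<^sub>R u) - \<phi> (x + t *\<^sub>R v) + \<phi> x) / t\<^sup>2 = ?f' s / t"
    proof -
      have "\<phi> (x + t *\<^sub>R u + t *\<^sub>R v) - \<phi> (x + t *\<^sub>R u) - \<phi> (x + t *\<^sub>R v) + \<phi> x = t * ?f' s"
        using s(3) by simp
      then show ?thesis using t by (simp add: power2_eq_square)
    qed
    then have "dist ((\<phi> (x + t *\<^sub>R u + t *\<^sub>R v) - \<phi> (x + t *\<^sub>R u)
      - \<phi> (x + t *\<^sub>R v) + \<phi> x) / t\<^sup>2) (D' v \<bullet> u) = \<bar>?f' s - t * (D' v \<bullet> u)\<bar> / t"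
    proof -
      have "?f' s / t - D' v \<bullet> u = (?f' s - t * (D' v \<bullet> u)) / t"
        using t by (simp add: field_simps)
      then show ?thesis
        using t \<open>_ = ?f' s / t\<close> by (simp only: dist_real_def abs_divide abs_of_pos)
    qed
    also have "\<dots> < e" using fin t by (simp add: divide_less_eq)
    finally show "dist ((\<phi> (x + t *\<^sub>R u + t *\<^sub>R v) - \<phi> (x + t *\<^sub>R u)
      - \<phi> (x + t *\<^sub>R v) + \<phi> x) / t\<^sup>2) (D' v \<bullet> u) < e" .
  qed
qed

lemma hessian_selfadjoint:
  assumes "C2_on U \<phi> D\<phi> D2\<phi>" "x \<in> U"
  shows "(D2\<phi> x *v u) \<bullet> v = u \<bullet> (D2\<phi> x *v v)"
proof -
  have *: "((\<lambda>t. (\<phi> (x + t *\<^sub>R u + t *\<^sub>R v) - \<phi> (x + t *\<^sub>R u) - \<phi> (x + t *\<^sub>R v) + \<phi> x) / t\<^sup>2)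
    \<longlongrightarrow> (D2\<phi> x *v v) \<bullet> u) (at_right 0)" for u v
    using assms unfolding C2_on_def by (intro second_difference_tendsto[of U _ _ D\<phi>]) auto
  have swap: "\<phi> (x + t *\<^sub>R u + t *\<^sub>R v) - \<phi> (x + t *\<^sub>R u) - \<phi> (x + t *\<^sub>R v) =
      \<phi> (x + t *\<^sub>R v + t *\<^sub>R u) - \<phi> (x + t *\<^sub>R v) - \<phi> (x + t *\<^sub>R u)" for t
    by (simp add: add.assoc add.commute[of "t *\<^sub>R u"])
  have "(D2\<phi> x *v v) \<bullet> u = (D2\<phi> x *v u) \<bullet> v"
    using tendsto_unique[OF _ *[of u v, unfolded swap] *[of v u]] by simp
  then show ?thesis by (simp add: inner_commute)
qed

text \<open>If the quadratic form were negative at \<open>h\<close>, then, since \<open>D\<close>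
  vanishes at \<open>x\<close>, the slope of \<psi> along the ray x + s h would be negative for
  small s > 0, and the mean value theorem would take \<psi> below its local minimum. In the proof
  \<open>f\<close> is minus this slope.\<close>

lemma gradient_hessian_local_min:
  assumes C2: "C2_on U \<psi> D H" "x \<in> U" and min: "\<forall>\<^sub>F y in nhds x. \<psi> x \<le> \<psi> y"
  shows "D x = 0" and "(H x *v h) \<bullet> h \<ge> 0"
proof -
  obtain S where S: "open S" "x \<in> S" "\<And>y. y \<in> S \<Longrightarrow> \<psi> x \<le> \<psi> y"
    using min unfolding eventually_nhds by blast
  have U: "open U" and grad: "\<And>y. y \<in> U \<Longrightarrow> (\<psi> has_derivative (\<lambda>h. h \<bullet> D y)) (at y)"
    and hess: "(D has_derivative (\<lambda>h. H x *v h)) (at x)"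
    using C2 unfolding C2_on_def gderiv_def by auto
  have "(\<lambda>h. h \<bullet> D x) = (\<lambda>h. 0)"
  proof (rule has_derivative_local_min[OF grad[OF C2(2)]])
    show "\<forall>\<^sub>F y in at x. \<psi> x \<le> \<psi> y"
      using min by (auto simp: eventually_at_filter elim: eventually_mono)
  qed
  then have "D x \<bullet> D x = 0" by metis
  then show D0: "D x = 0" by simp
  obtain d where d: "d > 0" "\<And>t. \<bar>t\<bar> < d \<Longrightarrow> x + t *\<^sub>R h \<in> S \<inter> U"
  proof -
    have "((\<lambda>t. x + t *\<^sub>R h) \<longlongrightarrow> x + 0 *\<^sub>R h) (nhds 0)"
      by (intro tendsto_intros) (simp add: filterlim_ident)
    then have "\<forall>\<^sub>F t in nhds 0. x + t *\<^sub>R h \<in> S \<inter> U"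
      using S(1,2) U C2(2) by (intro topological_tendstoD) auto
    then show thesis using that unfolding eventually_nhds_metric by (auto simp: dist_real_def)
  qed
  show "(H x *v h) \<bullet> h \<ge> 0"
  proof (rule ccontr)
    assume neg: "\<not> ?thesis"
    define f where "f t = - (D (x + t *\<^sub>R h) \<bullet> h)" for t
    have "((\<lambda>t. D (x + t *\<^sub>R h)) has_derivative (\<lambda>t. H x *v (t *\<^sub>R h))) (at 0)"
      by (rule has_derivative_compose[of _ "\<lambda>t. t *\<^sub>R h" _ _ D])
        (auto intro!: derivative_eq_intros simp: hess)
    then have "(f has_derivative (\<lambda>t. - ((H x *v (t *\<^sub>R h)) \<bullet> h))) (at 0)"
      unfolding f_def by (intro has_derivative_minus has_derivative_inner_left)
    then have "(f has_real_derivative - ((H x *v h) \<bullet> h)) (at 0)"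
      by (rule has_derivative_imp_has_field_derivative) (simp add: matrix_vector_mult_scaleR)
    from DERIV_pos_inc_right[OF this] neg obtain e where
      e: "e > 0" "\<And>t. 0 < t \<Longrightarrow> t < e \<Longrightarrow> f 0 < f t" by auto
    define t where "t = min d e / 2"
    have t: "0 < t" "t < d" "t < e" using d e by (auto simp: t_def min_def)
    have "((\<lambda>s. \<psi> (x + s *\<^sub>R h)) has_real_derivative - f s) (at s)" if "0 \<le> s" "s \<le> t" for s
    proof -
      have "x + s *\<^sub>R h \<in> U" using d(2)[of s] that t by auto
      then have "((\<lambda>s. \<psi> (x + s *\<^sub>R h)) has_derivative (\<lambda>r. (r *\<^sub>R h) \<bullet> D (x + s *\<^sub>R h))) (at s)"
        by (intro has_derivative_compose[of _ "\<lambda>t. t *\<^sub>R h" _ _ \<psi>] grad)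
          (auto intro!: derivative_eq_intros)
      then show ?thesis
        by (rule has_derivative_imp_has_field_derivative) (simp add: f_def inner_commute)
    qed
    from MVT2[OF t(1) this] obtain s where "0 < s" "s < t"
      "\<psi> (x + t *\<^sub>R h) - \<psi> (x + 0 *\<^sub>R h) = (t - 0) * - f s" by blast
    moreover have "f s > 0" using e(2)[of s] t \<open>0 < s\<close> \<open>s < t\<close> D0 by (simp add: f_def)
    then have "t * f s > 0" using \<open>f s > 0\<close> t by simp
    ultimately have "\<psi> (x + t *\<^sub>R h) < \<psi> x" by simp
    then show False using S(3)[of "x + t *\<^sub>R h"] d(2)[of t] t by auto
  qed
qed

lemma C2_on_diff:
  assumes "C2_on U \<phi> D\<phi> H\<phi>" "C2_on V \<psi> D\<psi> H\<psi>"
  shows "C2_on (U \<inter> V) (\<lambda>x. \<phi> x - \<psi> x) (\<lambda>x. D\<phi> x - D\<psi> x) (\<lambda>x. H\<phi> x - H\<psi> x)"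
proof -
  have "((\<lambda>x. D\<phi> x - D\<psi> x) has_derivative (\<lambda>h. (H\<phi> x - H\<psi> x) *v h)) (at x)" if "x \<in> U" "x \<in> V" for x
    using assms that unfolding C2_on_def matrix_vector_mult_diff_rdistrib
    by (intro has_derivative_diff) auto
  then show ?thesis using assms unfolding C2_on_def
    by (auto intro: GDERIV_diff continuous_on_diff continuous_on_subset)
qed

section \<open>Radial barriers\<close>

text \<open>
  The primitive of \<open>r / (c - b * r)\<close> that vanishes at \<open>0\<close>.
\<close>

definition radial_profile :: "real \<Rightarrow> real \<Rightarrow> real \<Rightarrow> real" where
  "radial_profile c b r = (if b = 0 then r\<^sup>2 / (2 * c) else - r / b - c / b\<^sup>2 * ln (1 - b * r / c))"

lemma DERIV_radial_profile:
  assumes "c > 0" "b \<ge> 0" "b * r < c"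
  shows "(radial_profile c b has_real_derivative r * (1 / (c - b * r))) (at r)"
proof (cases "b = 0")
  case True
  have "((\<lambda>r. r\<^sup>2 / (2 * c)) has_real_derivative r * (1 / c)) (at r)"
    using assms(1) by (auto intro!: derivative_eq_intros)
  then show ?thesis using True by (simp add: radial_profile_def[abs_def])
next
  case False
  have pos: "1 - b * r / c > 0" using assms by (simp add: field_simps)
  have "((\<lambda>r. ln (1 - b * r / c)) has_real_derivative - b / (c - b * r)) (at r)"
    using pos assms by (auto intro!: derivative_eq_intros simp: field_simps)
  then have "((\<lambda>r. - r / b - c / b\<^sup>2 * ln (1 - b * r / c)) has_real_derivative
      - 1 / b - c / b\<^sup>2 * (- b / (c - b * r))) (at r)"
    by (intro DERIV_diff DERIV_cmult DERIV_cdivide DERIV_minus DERIV_ident)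
  moreover have "- 1 / b - c / b\<^sup>2 * (- b / (c - b * r)) = r * (1 / (c - b * r))"
    using assms False by (simp add: power2_eq_square field_simps)
  ultimately show ?thesis using False by (simp add: radial_profile_def[abs_def])
qed

text \<open>Requiring the derivative of \<open>G\<close> as norm x times \<open>h\<close> avoids
  dividing by the norm. At the origin it forces G'(0) = 0, and the estimate G(r) - G(0) = o(r)
  carries over to y -> G(|y|).\<close>

lemma GDERIV_radial:
  fixes x :: "'a::real_inner"
  assumes "(G has_real_derivative norm x * h) (at (norm x))"
  shows "GDERIV (\<lambda>y. G (norm y)) x :> h *\<^sub>R x"
proof (cases "x = 0")
  case True
  then have "(G has_derivative (\<lambda>_. 0)) (at 0)"
    using assms by (simp add: has_field_derivative_def lambda_zero)
  then have G: "\<forall>e>0. \<exists>d>0. \<forall>y. norm (y - 0) < d \<longrightarrow> norm (G y - G 0 - 0) \<le> e * norm (y - 0)"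
    unfolding has_derivative_at_alt by blast
  have "((\<lambda>y::'a. G (norm y)) has_derivative (\<lambda>_. 0)) (at 0)"
    unfolding has_derivative_at_alt
  proof (intro conjI allI impI bounded_linear_zero)
    fix e :: real assume "e > 0"
    then obtain d where d: "d > 0" "\<And>y. norm (y - 0) < d \<Longrightarrow> norm (G y - G 0 - 0) \<le> e * norm (y - 0)"
      using G by blast
    show "\<exists>d>0. \<forall>y::'a. norm (y - 0) < d \<longrightarrow> norm (G (norm y) - G (norm (0::'a)) - 0) \<le> e * norm (y - 0)"
    proof (intro exI[of _ d] conjI allI impI d(1))
      fix y :: 'a assume "norm (y - 0) < d"
      then show "norm (G (norm y) - G (norm (0::'a)) - 0) \<le> e * norm (y - 0)"
        using d(2)[of "norm y"] by simp
    qed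
  qed
  then show ?thesis using True by (simp add: gderiv_def)
next
  case False
  then have "(norm x * h) *\<^sub>R sgn x = h *\<^sub>R x" by (simp add: sgn_div_norm)
  then show ?thesis
    using GDERIV_DERIV_compose[OF GDERIV_norm[OF False] assms] by simp
qed

text \<open>Away from the origin this is the product rule. At the origin continuity of
  \<open>h\<close> is enough: (h(|y|) - h(0)) y = o(|y|), and the term along \<open>x\<close> is
  zero.\<close>

lemma has_derivative_radial_field:
  fixes x :: "'a::real_inner"
  assumes "(h has_real_derivative h') (at (norm x))"
  shows "((\<lambda>y. h (norm y) *\<^sub>R y) has_derivative
    (\<lambda>v. h (norm x) *\<^sub>R v + (h' / norm x * (x \<bullet> v)) *\<^sub>R x)) (at x)"
proof (cases "x = 0")
  case False
  have "((\<lambda>y. h (norm y)) has_derivative (\<lambda>v. v \<bullet> (h' *\<^sub>R sgn x))) (at x)"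
    using GDERIV_DERIV_compose[OF GDERIV_norm[OF False] assms] by (simp add: gderiv_def)
  from has_derivative_scaleR[OF this has_derivative_ident]
  show ?thesis
    by (rule has_derivative_eq_rhs)
      (simp add: fun_eq_iff sgn_div_norm inner_commute[of x] divide_inverse mult.assoc)
next
  case True
  have cont: "isCont (\<lambda>y::'a. h (norm y)) 0"
    using isCont_o2[where f = norm and g = h and a = "0::'a"] DERIV_isCont[OF assms] True
    by simp
  have "((\<lambda>y::'a. h (norm y) *\<^sub>R y) has_derivative (\<lambda>v. h 0 *\<^sub>R v)) (at 0)"
    unfolding has_derivative_at_alt
  proof (intro conjI allI impI bounded_linear_scaleR_right)
    fix e :: real assume "e > 0"
    then obtain d where d: "d > 0" "\<And>y::'a. norm y < d \<Longrightarrow> \<bar>h (norm y) - h 0\<bar> < e"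
      using cont by (auto simp: isCont_def LIM_def dist_real_def) (metis norm_zero diff_self abs_zero)
    show "\<exists>d>0. \<forall>y::'a. norm (y - 0) < d \<longrightarrow>
        norm (h (norm y) *\<^sub>R y - h (norm (0::'a)) *\<^sub>R 0 - h 0 *\<^sub>R (y - 0)) \<le> e * norm (y - 0)"
      using d(1) by (intro exI[of _ d])
        (auto simp: scaleR_left_diff_distrib[symmetric] intro!: mult_right_mono d(2)[THEN less_imp_le])
  qed
  then show ?thesis using True by simp
qed

text \<open>
  At the origin Isabelle's \<open>x / 0 = 0\<close> gives the rank-one part its continuous value \<open>0\<close>.
\<close>

definition radial_hessian :: "real \<Rightarrow> real \<Rightarrow> real^'n \<Rightarrow> real^'n^'n" where
  "radial_hessian h h' x = h *\<^sub>R mat 1 + h' *\<^sub>R (\<chi> i j. x $ i * x $ j / norm x)"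

lemma radial_hessian_mult:
  "radial_hessian h h' x *v v = h *\<^sub>R v + (h' / norm x * (x \<bullet> v)) *\<^sub>R x"
proof -
  have "(\<chi> i j. x $ i * x $ j / norm x) *v v = ((x \<bullet> v) / norm x) *\<^sub>R x"
    by (simp add: vec_eq_iff matrix_vector_mult_def inner_vec_def sum_distrib_left
        sum_distrib_right sum_divide_distrib mult_ac)
  then show ?thesis
    by (simp add: radial_hessian_def matrix_vector_mult_add_rdistrib
        scaleR_matrix_vector_assoc[symmetric])
qed

lemma continuous_on_radial_hessian:
  fixes U :: "(real^'n) set"
  assumes "continuous_on U h" "continuous_on U h'"
  shows "continuous_on U (\<lambda>x. radial_hessian (h x) (h' x) x)"
proof -
  have "isCont (\<lambda>x::real^'n. x $ i * x $ j / norm x) x" for i j x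
  proof (cases "x = 0")
    case False
    then show ?thesis by (intro continuous_intros) auto
  next
    case True
    \<comment> \<open>This bound makes the entries of the rank-one part tend to 0 at the origin, the
      value assigned to them there.\<close>
    have "\<bar>y $ i * y $ j / norm y\<bar> \<le> norm y" for y :: "real^'n"
    proof (cases "y = 0")
      case False
      have "\<bar>y $ i\<bar> * \<bar>y $ j\<bar> \<le> norm y * norm y"
        by (intro mult_mono component_le_norm_cart) auto
      then show ?thesis using False by (simp add: abs_mult divide_le_eq)
    qed simp
    then have "((\<lambda>y::real^'n. y $ i * y $ j / norm y) \<longlongrightarrow> 0) (at 0)"
      by (intro Lim_null_comparison[OF _ tendsto_norm_zero[OF tendsto_ident_at]] always_eventually) simp
    then show ?thesis using True by (simp add: isCont_def)
  qed
  then have "continuous_on U (\<lambda>x::real^'n. x $ i * x $ j / norm x)" for i j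
    using continuous_at_imp_continuous_on by blast
  then have "continuous_on U (\<lambda>x::real^'n. \<chi> i j. x $ i * x $ j / norm x)"
    by (intro continuous_on_vec_lambda)
  then show ?thesis
    unfolding radial_hessian_def
    by (intro continuous_on_add continuous_on_scaleR assms continuous_on_const)
qed

text \<open>With g = s (K - \<open>radial_profile\<close>), the coefficient -s/(c - br) is h = g'/r,
  and -sb/(c - br)^2 is h'. The constant \<open>K\<close> selects the radius at which the barrier
  vanishes; \<open>s\<close> serves to make it strict.\<close>

lemma C2_on_barrier:
  assumes "c > 0" "b \<ge> 0"
  shows "C2_on {x. b * norm x < c} (\<lambda>x. s * (K - radial_profile c b (norm x)))
    (\<lambda>x. - (s / (c - b * norm x)) *\<^sub>R x)
    (\<lambda>x. radial_hessian (- (s / (c - b * norm x))) (- (s * b / (c - b * norm x)\<^sup>2)) x)"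
proof -
  let ?U = "{x::real^'n. b * norm x < c}"
  let ?h = "\<lambda>r. - (s / (c - b * r))"
  have "open ?U" by (intro open_Collect_less continuous_intros)
  moreover have "GDERIV (\<lambda>x. s * (K - radial_profile c b (norm x))) x :> ?h (norm x) *\<^sub>R x"
    if "x \<in> ?U" for x
  proof (rule GDERIV_radial[where G = "\<lambda>r. s * (K - radial_profile c b r)"])
    show "((\<lambda>r. s * (K - radial_profile c b r)) has_real_derivative norm x * ?h (norm x)) (at (norm x))"
      using that assms by (auto intro!: derivative_eq_intros DERIV_radial_profile)
  qed
  moreover have "((\<lambda>x. ?h (norm x) *\<^sub>R x) has_derivative
      (\<lambda>v. radial_hessian (?h (norm x)) (- (s * b / (c - b * norm x)\<^sup>2)) x *v v)) (at x)" if "x \<in> ?U" for x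
    unfolding radial_hessian_mult
  proof (rule has_derivative_radial_field)
    show "(?h has_real_derivative - (s * b / (c - b * norm x)\<^sup>2)) (at (norm x))"
      using that by (auto intro!: derivative_eq_intros simp: power2_eq_square)
  qed
  moreover have "continuous_on ?U (\<lambda>x. radial_hessian (?h (norm x)) (- (s * b / (c - b * norm x)\<^sup>2)) x)"
    by (intro continuous_on_radial_hessian continuous_intros) auto
  ultimately show ?thesis unfolding C2_on_def by blast
qed

section \<open>Comparison with the barriers\<close>

text \<open>Without a minimiser each x is strictly beaten by some m x, also on a neighbourhood T x.
  Among the centres of a finite subcover take c with f (m c) least: m c lies in some T x, so f (m x)
  is smaller still.\<close>

lemma lsc_on_attains_inf:
  fixes f :: "'a::topological_space \<Rightarrow> real"
  assumes "compact S" "S \<noteq> {}" "lsc_on S f"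
  shows "\<exists>x\<in>S. \<forall>y\<in>S. f x \<le> f y"
proof (rule ccontr)
  assume "\<not> ?thesis"
  then obtain m where m: "\<And>x. x \<in> S \<Longrightarrow> m x \<in> S \<and> f (m x) < f x"
    by (metis not_le)
  have "\<exists>T. open T \<and> x \<in> T \<and> (\<forall>z\<in>S \<inter> T. f (m x) < f z)" if "x \<in> S" for x
  proof -
    have "\<forall>\<^sub>F z in at x within S. f (m x) < f z"
      using assms(3) m that unfolding lsc_on_def by blast
    then obtain T where "open T" "x \<in> T" "\<forall>z\<in>T. z \<noteq> x \<longrightarrow> z \<in> S \<longrightarrow> f (m x) < f z"
      unfolding eventually_at_topological by blast
    then show ?thesis using m[OF that] by (intro exI[of _ T]) auto
  qed
  then obtain T where T: "\<And>x. x \<in> S \<Longrightarrow> open (T x) \<and> x \<in> T x \<and> (\<forall>z\<in>S \<inter> T x. f (m x) < f z)"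
    by metis
  obtain C where C: "C \<subseteq> S" "finite C" "S \<subseteq> \<Union>(T ` C)"
    using compactE_image[OF assms(1), of S T] T by blast
  have "C \<noteq> {}" using C assms(2) by auto
  then obtain c where c: "c \<in> C" "\<And>x. x \<in> C \<Longrightarrow> f (m c) \<le> f (m x)"
    using ex_min_if_finite[of "(\<lambda>x. f (m x)) ` C"] C(2) by (auto simp: not_less)
  have "m c \<in> S" using c(1) C(1) m by blast
  then obtain x where "x \<in> C" "m c \<in> T x" using C(3) by blast
  then have "f (m x) < f (m c)" using T[of x] \<open>m c \<in> S\<close> C(1) by blast
  then show False using c(2)[OF \<open>x \<in> C\<close>] by simp
qed

lemma lsc_on_subset:
  assumes "lsc_on S f" "T \<subseteq> S"
  shows "lsc_on T f"
  unfolding lsc_on_def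
proof (intro ballI allI impI)
  fix x c assume "x \<in> T" "c < f x"
  then have "\<forall>\<^sub>F y in at x within S. c < f y" using assms unfolding lsc_on_def by blast
  then show "\<forall>\<^sub>F y in at x within T. c < f y" by (rule filter_leD[OF at_le[OF assms(2)]])
qed

lemma lsc_on_diff_continuous:
  assumes "lsc_on S f" "continuous_on S g"
  shows "lsc_on S (\<lambda>x. f x - g x)"
  unfolding lsc_on_def
proof (intro ballI allI impI)
  fix x c assume x: "x \<in> S" and c: "c < f x - g x"
  define e where "e = (f x - g x - c) / 2"
  have e: "e > 0" using c by (simp add: e_def)
  have "\<forall>\<^sub>F y in at x within S. f x - e < f y"
    using assms(1) x e unfolding lsc_on_def by simp
  moreover have "\<forall>\<^sub>F y in at x within S. g y < g x + e"
    using assms(2) x e unfolding continuous_on_def by (intro order_tendstoD(2)) auto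
  ultimately show "\<forall>\<^sub>F y in at x within S. c < f y - g y"
    by eventually_elim (use c in \<open>simp add: e_def field_simps\<close>)
qed

lemma continuous_imp_lsc_on: "continuous_on S (f :: 'a::topological_space \<Rightarrow> real) \<Longrightarrow> lsc_on S f"
  unfolding lsc_on_def continuous_on_def by (auto intro: order_tendstoD)

lemma continuous_imp_usc_on: "continuous_on S (f :: 'a::topological_space \<Rightarrow> real) \<Longrightarrow> usc_on S f"
  unfolding usc_on_def continuous_on_def by (auto intro: order_tendstoD)

text \<open>At an interior minimum of v - \<phi> the function \<phi> is itself an admissible test
  function and strictness gives a contradiction, so the minimum lies on the sphere. The comparison
  ball may be smaller than the ball of radius \<open>R\<close>, as the nonexistence argument
  demands.\<close>

lemma supersolution_ge_strict_subsolution: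
  assumes v: "visc_supersolution k b R v" "lsc_on (cball 0 R) v" and r: "0 < r" "r \<le> R"
    and C2: "C2_on U \<phi> D H" "ball 0 r \<subseteq> U" and cont: "continuous_on (cball 0 r) \<phi>"
    and bd: "\<And>x. x \<in> sphere 0 r \<Longrightarrow> \<phi> x \<le> v x"
    and strict: "\<And>x. x \<in> ball 0 r \<Longrightarrow> Pk_plus k (H x) + b * norm (D x) > -1"
    and x: "x \<in> cball 0 r"
  shows "\<phi> x \<le> v x"
proof -
  have "cball 0 r \<subseteq> cball (0::real^'a) R" using r by auto
  then have "lsc_on (cball 0 r) (\<lambda>x. v x - \<phi> x)"
    using lsc_on_subset[OF v(2)] cont by (intro lsc_on_diff_continuous)
  then obtain z where z: "z \<in> cball 0 r" "\<And>y. y \<in> cball 0 r \<Longrightarrow> v z - \<phi> z \<le> v y - \<phi> y"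
    using lsc_on_attains_inf[OF compact_cball, of 0 r] x by blast
  have "z \<notin> ball 0 r"
  proof
    assume zb: "z \<in> ball 0 r"
    have "\<forall>\<^sub>F y in nhds z. v y - \<phi> y \<ge> v z - \<phi> z"
      using eventually_nhds_in_open[OF open_ball zb] z(2) ball_subset_cball
      by (auto elim!: eventually_mono)
    moreover have "z \<in> ball 0 R" "z \<in> U" using zb r C2(2) by auto
    ultimately have "Pk_plus k (H z) + b * norm (D z) \<le> -1"
      using v(1) C2(1) unfolding visc_supersolution_def by blast
    then show False using strict[OF zb] by simp
  qed
  then have "z \<in> sphere 0 r" using z(1) by auto
  then show ?thesis using bd z(2)[OF x] by fastforce
qed

lemma subsolution_le_strict_supersolution:
  assumes v: "visc_subsolution k b R v" "continuous_on (cball 0 R) v"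
    and C2: "C2_on U \<phi> D H" "ball 0 R \<subseteq> U" and cont: "continuous_on (cball 0 R) \<phi>"
    and bd: "\<And>x. x \<in> sphere 0 R \<Longrightarrow> v x \<le> \<phi> x"
    and strict: "\<And>x. x \<in> ball 0 R \<Longrightarrow> Pk_plus k (H x) + b * norm (D x) < -1"
    and x: "x \<in> cball 0 R"
  shows "v x \<le> \<phi> x"
proof -
  have "continuous_on (cball 0 R) (\<lambda>x. v x - \<phi> x)"
    using v(2) cont by (intro continuous_on_diff)
  then obtain z where z: "z \<in> cball 0 R" "\<And>y. y \<in> cball 0 R \<Longrightarrow> v y - \<phi> y \<le> v z - \<phi> z"
    using continuous_attains_sup[OF compact_cball, of 0 R] x by blast
  have "z \<notin> ball 0 R"
  proof
    assume zb: "z \<in> ball 0 R"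
    have "\<forall>\<^sub>F y in nhds z. v y - \<phi> y \<le> v z - \<phi> z"
      using eventually_nhds_in_open[OF open_ball zb] z(2) ball_subset_cball
      by (auto elim!: eventually_mono)
    moreover have "z \<in> U" using zb C2(2) by auto
    ultimately have "Pk_plus k (H z) + b * norm (D z) \<ge> -1"
      using v(1) C2(1) zb unfolding visc_subsolution_def by blast
    then show False using strict[OF zb] by simp
  qed
  then have "z \<in> sphere 0 R" using z(1) by auto
  then show ?thesis using bd z(2)[OF x] by fastforce
qed

section \<open>The explicit radial function is a viscosity solution\<close>

lemma C2_touching:
  assumes w: "C2_on U w Dw Hw" "x \<in> U" and \<phi>: "C2_on V \<phi> D\<phi> H\<phi>" "x \<in> V"
    and touch: "\<forall>\<^sub>F y in nhds x. w x - \<phi> x \<le> w y - \<phi> y"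
  shows "D\<phi> x = Dw x" "(H\<phi> x *v h) \<bullet> h \<le> (Hw x *v h) \<bullet> h"
  using gradient_hessian_local_min[OF C2_on_diff[OF w(1) \<phi>(1)] _ touch] w(2) \<phi>(2)
  by (auto simp: matrix_vector_mult_diff_rdistrib inner_diff_left)

lemma radial_hessian_quadratic_le:
  assumes "h' \<le> 0"
  shows "(radial_hessian h h' x *v y) \<bullet> y \<le> h * (y \<bullet> y)"
proof -
  have "h' / norm x * (x \<bullet> y) * (x \<bullet> y) \<le> 0"
    using assms by (simp add: mult.assoc mult_nonpos_nonneg divide_nonpos_nonneg)
  then show ?thesis by (simp add: radial_hessian_mult inner_add_left)
qed

lemma radial_hessian_quadratic_orthogonal:
  "y \<bullet> x = 0 \<Longrightarrow> (radial_hessian h h' x *v y) \<bullet> y = h * (y \<bullet> y)"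
  by (simp add: radial_hessian_mult inner_commute)

text \<open>The eigenvalue in direction \<open>x\<close> is h + h' |x| <= h and all others equal
  \<open>h\<close>. The upper bound uses the form on the whole space, the lower bound its
  restriction to the hyperplane orthogonal to \<open>x\<close>.\<close>

lemma Pk_plus_radial_hessian:
  fixes x :: "real^'n"
  assumes "h' \<le> 0" "k < CARD('n)"
  shows "Pk_plus k (radial_hessian h h' x) = real k * h"
proof (rule antisym)
  have sym: "(radial_hessian h h' x *v y) \<bullet> z = y \<bullet> (radial_hessian h h' x *v z)" for y z
    by (simp add: radial_hessian_mult inner_add_left inner_add_right inner_commute)
  show "Pk_plus k (radial_hessian h h' x) \<le> real k * h"
    using assms by (intro Pk_plus_le sym radial_hessian_quadratic_le) auto
  show "real k * h \<le> Pk_plus k (radial_hessian h h' x)"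
    using assms by (intro Pk_plus_ge[where z = x] sym) (auto simp: radial_hessian_quadratic_orthogonal)
qed

text \<open>With q = s/(c - b|x|) >= 0 the gradient has norm q|x|, so the two terms add up to -q (c
  - b|x|).\<close>

lemma barrier_constant:
  assumes "b * norm x < c" "s \<ge> 0"
  shows "c * - (s / (c - b * norm x)) + b * norm (- (s / (c - b * norm x)) *\<^sub>R x) = - s"
proof -
  define q where "q = s / (c - b * norm x)"
  have "q \<ge> 0" "q * (c - b * norm x) = s" using assms by (simp_all add: q_def)
  then show ?thesis unfolding q_def[symmetric] by (simp add: algebra_simps)
qed

lemma barrier_equation:
  fixes x :: "real^'n"
  assumes "b * norm x < real k" "s \<ge> 0" "b \<ge> 0" "k < CARD('n)"
  shows "Pk_plus k (radial_hessian (- (s / (real k - b * norm x))) (- (s * b / (real k - b * norm x)\<^sup>2)) x)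
    + b * norm (- (s / (real k - b * norm x)) *\<^sub>R x) = - s"
  using assms barrier_constant[OF assms(1,2)] by (subst Pk_plus_radial_hessian) auto

lemma continuous_on_barrier:
  fixes S :: "(real^'n) set"
  assumes "c > 0" "b \<ge> 0" "\<And>x. x \<in> S \<Longrightarrow> b * norm x < c"
  shows "continuous_on S (\<lambda>x. s * (K - radial_profile c b (norm x)))"
proof -
  have "GDERIV (\<lambda>x. s * (K - radial_profile c b (norm x))) x :> - (s / (c - b * norm x)) *\<^sub>R x"
    if "x \<in> S" for x
    using C2_on_barrier[OF assms(1,2)] assms(3)[OF that] unfolding C2_on_def by blast
  then show ?thesis
    unfolding gderiv_def by (intro continuous_at_imp_continuous_on ballI has_derivative_continuous)
qed

text \<open>A test function touching from below has a smaller Hessian form than the barrier, which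
  is bounded by h|y|^2 in all directions. One touching from above has a larger form, which only
  needs to be compared with h|y|^2 for y orthogonal to \<open>x\<close>. The gradients agree, so
  both inequalities reduce to \<open>barrier_constant\<close> with s = 1.\<close>

lemma radial_solution:
  fixes k :: nat and R b :: real
  assumes k: "1 \<le> k" "k < CARD('n::finite)" and R: "R > 0" and b: "b \<ge> 0" "b * R < real k"
  shows "dirichlet_solution k b R
    (\<lambda>x::real^'n. radial_profile (real k) b R - radial_profile (real k) b (norm x))"
    (is "dirichlet_solution k b R ?w")
proof -
  have in_U: "b * norm x < real k" if "x \<in> cball 0 R" for x :: "real^'n"
    using that b mult_left_mono[of "norm x" R b] by simp
  have kpos: "real k > 0" using k by simp
  let ?D = "\<lambda>x. - (1 / (real k - b * norm x)) *\<^sub>R x"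
  let ?H = "\<lambda>x. radial_hessian (- (1 / (real k - b * norm x))) (- (1 * b / (real k - b * norm x)\<^sup>2)) x"
  have C2: "C2_on {x. b * norm x < real k} ?w ?D ?H"
    using C2_on_barrier[OF kpos b(1), of 1] by simp
  have "continuous_on (cball 0 R) (\<lambda>x. 1 * ?w x)"
    by (rule continuous_on_barrier[OF kpos b(1) in_U])
  then have cont: "continuous_on (cball 0 R) ?w" by simp
  have curv: "- (1 * b / (real k - b * norm x)\<^sup>2) \<le> 0" for x :: "real^'n"
    using b by simp
  have const: "real k * - (1 / (real k - b * norm x)) + b * norm (?D x) = - 1"
    if "x \<in> ball 0 R" for x :: "real^'n"
    using that by (intro barrier_constant in_U) auto
  have "visc_supersolution k b R ?w"
    unfolding visc_supersolution_def
  proof (intro conjI ballI allI impI)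
    show "lsc_on (ball 0 R) ?w"
      using cont by (intro continuous_imp_lsc_on) (rule continuous_on_subset, auto)
    fix x U \<phi> D\<phi> and H :: "real^'n \<Rightarrow> real^'n^'n"
    assume x: "x \<in> ball 0 R" "x \<in> U" and \<phi>: "C2_on U \<phi> D\<phi> H"
      and touch: "\<forall>\<^sub>F y in nhds x. ?w y - \<phi> y \<ge> ?w x - \<phi> x"
    have "x \<in> {x. b * norm x < real k}" using in_U x by auto
    note t = C2_touching[OF C2 this \<phi> x(2) touch]
    have "(H x *v y) \<bullet> y \<le> - (1 / (real k - b * norm x)) * (y \<bullet> y)" for y
      using t(2)[of y] radial_hessian_quadratic_le[OF curv] order_trans by blast
    then have "Pk_plus k (H x) \<le> real k * - (1 / (real k - b * norm x))"
      using k hessian_selfadjoint[OF \<phi> x(2)] by (intro Pk_plus_le) auto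
    then show "Pk_plus k (H x) + b * norm (D\<phi> x) \<le> -1"
      unfolding t(1) using const[OF x(1)] by linarith
  qed
  moreover have "visc_subsolution k b R ?w"
    unfolding visc_subsolution_def
  proof (intro conjI ballI allI impI)
    show "usc_on (ball 0 R) ?w"
      using cont by (intro continuous_imp_usc_on) (rule continuous_on_subset, auto)
    fix x U \<phi> D\<phi> and H :: "real^'n \<Rightarrow> real^'n^'n"
    assume x: "x \<in> ball 0 R" "x \<in> U" and \<phi>: "C2_on U \<phi> D\<phi> H"
      and "\<forall>\<^sub>F y in nhds x. ?w y - \<phi> y \<le> ?w x - \<phi> x"
    then have touch: "\<forall>\<^sub>F y in nhds x. \<phi> x - ?w x \<le> \<phi> y - ?w y"
      by (auto elim: eventually_mono)
    have "x \<in> {x. b * norm x < real k}" using in_U x by auto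
    note t = C2_touching[OF \<phi> x(2) C2 this touch]
    have "- (1 / (real k - b * norm x)) * (y \<bullet> y) \<le> (H x *v y) \<bullet> y" if "y \<bullet> x = 0" for y
      using t(2)[of y] radial_hessian_quadratic_orthogonal[OF that] by metis
    then have "real k * - (1 / (real k - b * norm x)) \<le> Pk_plus k (H x)"
      using k hessian_selfadjoint[OF \<phi> x(2)] by (intro Pk_plus_ge[where z = x]) auto
    then show "Pk_plus k (H x) + b * norm (D\<phi> x) \<ge> -1"
      unfolding t(1)[symmetric] using const[OF x(1)] by linarith
  qed
  ultimately show ?thesis
    using cont unfolding dirichlet_solution_def by simp
qed

text \<open>
  Scaling the explicit solution by \<open>s\<close> changes the right-hand side to \<open>- s\<close>, so factors \<open>s > 1\<close> and
  \<open>s < 1\<close> give strict super- and subsolutions that can be compared as \<open>C\<^sup>2\<close> test functions.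
\<close>

lemma le_if_le_scaled_above:
  fixes v w :: real
  assumes "\<And>s. s > 1 \<Longrightarrow> v \<le> s * w"
  shows "v \<le> w"
proof (rule tendsto_lowerbound)
  show "((\<lambda>s. s * w) \<longlongrightarrow> w) (at_right 1)"
    by (rule tendsto_eq_intros refl)+ simp
  show "\<forall>\<^sub>F s in at_right 1. v \<le> s * w"
    using assms by (auto intro: eventually_at_rightI[of 1 2])
qed simp

lemma ge_if_ge_scaled_below:
  fixes v w :: real
  assumes "\<And>s. 0 < s \<Longrightarrow> s < 1 \<Longrightarrow> s * w \<le> v"
  shows "w \<le> v"
proof (rule tendsto_upperbound)
  show "((\<lambda>s. s * w) \<longlongrightarrow> w) (at_left 1)"
    by (rule tendsto_eq_intros refl)+ simp
  show "\<forall>\<^sub>F s in at_left 1. s * w \<le> v"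
    using assms by (auto intro: eventually_at_leftI[of 0 1])
qed simp

text \<open>For 0 < s < 1 the scaled barrier satisfies the equation with right-hand side -s > -1,
  hence is a strict subsolution; then s tends to 1. Uniqueness uses r = R, nonexistence a radius
  with b r < k.\<close>

lemma barrier_le_supersolution:
  fixes v :: "real^'n \<Rightarrow> real"
  assumes k: "1 \<le> k" "k < CARD('n)" and b: "b \<ge> 0" "b * r < real k" and r: "0 < r" "r \<le> R"
    and v: "visc_supersolution k b R v" "lsc_on (cball 0 R) v"
    and bd: "\<And>x. x \<in> sphere 0 r \<Longrightarrow> v x \<ge> 0" and x: "x \<in> cball 0 r"
  shows "radial_profile (real k) b r - radial_profile (real k) b (norm x) \<le> v x"
proof (rule ge_if_ge_scaled_below)
  fix s :: real assume s: "0 < s" "s < 1"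
  have in_U: "b * norm x < real k" if "x \<in> cball 0 r" for x :: "real^'n"
    using that b mult_left_mono[of "norm x" r b] by simp
  have kpos: "real k > 0" using k by simp
  show "s * (radial_profile (real k) b r - radial_profile (real k) b (norm x)) \<le> v x"
  proof (rule supersolution_ge_strict_subsolution[OF v r C2_on_barrier[OF kpos b(1)]])
    show "ball 0 r \<subseteq> {x::real^'n. b * norm x < real k}"
      using in_U[OF subsetD[OF ball_subset_cball]] by blast
    show "continuous_on (cball 0 r) (\<lambda>x::real^'n. s * (radial_profile k b r - radial_profile k b (norm x)))"
      using kpos b(1) in_U by (rule continuous_on_barrier)
    fix y :: "real^'n" assume "y \<in> ball 0 r"
    then have "b * norm y < real k" using in_U[OF subsetD[OF ball_subset_cball]] by blast
    from barrier_equation[OF this _ b(1) k(2)]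
    show "Pk_plus k (radial_hessian (- (s / (real k - b * norm y))) (- (s * b / (real k - b * norm y)\<^sup>2)) y)
        + b * norm (- (s / (real k - b * norm y)) *\<^sub>R y) > -1"
      using s by simp
  qed (use s bd x in auto)
qed

lemma subsolution_le_barrier:
  fixes v :: "real^'n \<Rightarrow> real"
  assumes k: "1 \<le> k" "k < CARD('n)" and b: "b \<ge> 0" "b * R < real k"
    and v: "visc_subsolution k b R v" "continuous_on (cball 0 R) v"
    and bd: "\<And>x. x \<in> sphere 0 R \<Longrightarrow> v x \<le> 0" and x: "x \<in> cball 0 R"
  shows "v x \<le> radial_profile (real k) b R - radial_profile (real k) b (norm x)"
proof (rule le_if_le_scaled_above)
  fix s :: real assume s: "s > 1"
  have in_U: "b * norm x < real k" if "x \<in> cball 0 R" for x :: "real^'n"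
    using that b mult_left_mono[of "norm x" R b] by simp
  have kpos: "real k > 0" using k by simp
  show "v x \<le> s * (radial_profile (real k) b R - radial_profile (real k) b (norm x))"
  proof (rule subsolution_le_strict_supersolution[OF v C2_on_barrier[OF kpos b(1)]])
    show "ball 0 R \<subseteq> {x::real^'n. b * norm x < real k}"
      using in_U[OF subsetD[OF ball_subset_cball]] by blast
    show "continuous_on (cball 0 R) (\<lambda>x::real^'n. s * (radial_profile k b R - radial_profile k b (norm x)))"
      using kpos b(1) in_U by (rule continuous_on_barrier)
    fix y :: "real^'n" assume "y \<in> ball 0 R"
    then have "b * norm y < real k" using in_U[OF subsetD[OF ball_subset_cball]] by blast
    from barrier_equation[OF this _ b(1) k(2)]
    show "Pk_plus k (radial_hessian (- (s / (real k - b * norm y))) (- (s * b / (real k - b * norm y)\<^sup>2)) y)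
        + b * norm (- (s / (real k - b * norm y)) *\<^sub>R y) < -1"
      using s by simp
  qed (use s bd x in auto)
qed

section \<open>Nonexistence of supersolutions when b R >= k\<close>

lemma supersolution_nonneg:
  fixes v :: "real^'n \<Rightarrow> real"
  assumes "k < CARD('n)" "R > 0" "dirichlet_supersolution k b R v" "x \<in> cball 0 R"
  shows "v x \<ge> 0"
proof -
  \<comment> \<open>The constant 0 is a strict subsolution, since 0 > -1. Comparison with it gives
    the sign on interior spheres, where the barriers of smaller balls need it.\<close>
  have C2: "C2_on UNIV (\<lambda>_. 0) (\<lambda>_. 0) (\<lambda>_. 0 :: real^'n^'n)"
    unfolding C2_on_def by (simp add: GDERIV_const matrix_vector_mult_def[abs_def] zero_vec_def[symmetric])
  have Pk: "Pk_plus k (0 :: real^'n^'n) \<ge> real k * 0"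
    using assms(1) by (intro Pk_plus_ge[where z = 0]) auto
  have v: "visc_supersolution k b R v" "lsc_on (cball 0 R) v"
    and bd: "\<And>y. y \<in> sphere 0 R \<Longrightarrow> 0 \<le> v y"
    using assms(3) unfolding dirichlet_supersolution_def by auto
  show ?thesis
    by (rule supersolution_ge_strict_subsolution[OF v assms(2) order_refl C2])
      (use Pk bd assms(4) in auto)
qed

lemma no_supersolution:
  fixes v :: "real^'n \<Rightarrow> real"
  assumes k: "1 \<le> k" "k < CARD('n)" and R: "R > 0" and b: "b \<ge> 0" "b * R \<ge> real k"
  shows "\<not> dirichlet_supersolution k b R v"
proof
  assume v: "dirichlet_supersolution k b R v"
  have kpos: "real k > 0" using k by simp
  have "b \<noteq> 0" using b(2) kpos by auto
  then have bpos: "b > 0" using b(1) by simp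
  \<comment> \<open>The radius \<open>r\<close> below is chosen so that -ln(1 - br/k) is exactly
    \<open>M\<close>. The barrier at the origin is then kM/b^2 - r/b >= (k/b^2)(M - 1), and
    \<open>M\<close> makes the last expression equal to |v 0| + 1, which exceeds v 0.\<close>
  define M where "M = 1 + (\<bar>v 0\<bar> + 1) * b\<^sup>2 / real k"
  have M: "M > 0" unfolding M_def using kpos by (intro add_pos_nonneg) auto
  define r where "r = real k / b * (1 - exp (- M))"
  have br: "b * r = real k * (1 - exp (- M))" using bpos by (simp add: r_def)
  have r: "r > 0" "b * r < real k" unfolding br unfolding r_def using kpos bpos M by simp_all
  have "b * r < b * R" using r(2) b(2) by simp
  then have "r \<le> R" using bpos by simp
  moreover have "v x \<ge> 0" if "x \<in> sphere 0 r" for x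
    using supersolution_nonneg[OF k(2) R v, of x] that \<open>r \<le> R\<close> by simp
  ultimately have "radial_profile k b r - radial_profile k b (norm (0::real^'n)) \<le> v 0"
    using v r unfolding dirichlet_supersolution_def
    by (intro barrier_le_supersolution[OF k b(1) r(2,1)]) auto
  moreover have "radial_profile k b r = - r / b + real k / b\<^sup>2 * M"
  proof -
    have "1 - b * r / real k = exp (- M)" unfolding br using kpos by simp
    then show ?thesis using \<open>b \<noteq> 0\<close> by (simp add: radial_profile_def)
  qed
  moreover have "r / b \<le> real k / b\<^sup>2"
    using r(2) bpos by (simp add: field_simps power2_eq_square)
  moreover have "real k / b\<^sup>2 * M = real k / b\<^sup>2 + \<bar>v 0\<bar> + 1"
    using kpos bpos by (simp add: M_def field_simps)
  moreover have "radial_profile k b (norm (0::real^'n)) = 0"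
    by (simp add: radial_profile_def)
  ultimately show False by linarith
qed

theorem proposition17:
  fixes k :: nat and R b :: real
  assumes "1 \<le> k" and "k < CARD('n::finite)" and "R > 0" and "b \<ge> 0"
  shows "(0 \<le> b * R \<and> b * R < real k \<longrightarrow>
      (\<exists>u :: real^'n \<Rightarrow> real. dirichlet_solution k b R u \<and> radial_on (cball 0 R) u \<and>
         (\<forall>v. dirichlet_solution k b R v \<longrightarrow> (\<forall>x\<in>cball 0 R. v x = u x)))) \<and>
    (b * R \<ge> real k \<longrightarrow>
      \<not> (\<exists>u :: real^'n \<Rightarrow> real. dirichlet_supersolution k b R u))"
proof (intro conjI impI)
  assume bR: "0 \<le> b * R \<and> b * R < real k"
  let ?w = "\<lambda>x::real^'n. radial_profile (real k) b R - radial_profile (real k) b (norm x)"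
  have "v x = ?w x" if v: "dirichlet_solution k b R v" and x: "x \<in> cball 0 R" for v x
  proof (rule antisym)
    show "v x \<le> ?w x"
      using v x bR assms unfolding dirichlet_solution_def by (intro subsolution_le_barrier) auto
    show "?w x \<le> v x"
      using v x bR assms unfolding dirichlet_solution_def
      by (intro barrier_le_supersolution[where R = R] continuous_imp_lsc_on) auto
  qed
  moreover have "radial_on (cball 0 R) ?w"
    unfolding radial_on_def
    by (intro exI[of _ "\<lambda>r. radial_profile (real k) b R - radial_profile (real k) b r"]) simp
  moreover have "dirichlet_solution k b R ?w"
    using bR by (intro radial_solution[OF assms]) auto
  ultimately show "\<exists>u :: real^'n \<Rightarrow> real. dirichlet_solution k b R u \<and> radial_on (cball 0 R) u \<and>
         (\<forall>v. dirichlet_solution k b R v \<longrightarrow> (\<forall>x\<in>cball 0 R. v x = u x))"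
    by blast
next
  assume "b * R \<ge> real k"
  then show "\<not> (\<exists>u :: real^'n \<Rightarrow> real. dirichlet_supersolution k b R u)"
    using no_supersolution assms by blast
qed

end
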